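(* Let $V$ be a finite-dimensional complex vector space with a Hermitian inner product, let $K$ be a compact connected Lie group with Lie algebra $\mathfrak{k}$ acting on $V$ via a unitary representation, and let $\tau:V\to\mathfrak{k}^*$ be the moment map. If $\tau$ is finite-to-one on $K$-orbits, then $\tau$ is uniformly finite-to-one on $K$-orbits, i.e. there is a constant $M$ such that for all $\alpha\in\mathfrak{k}^*$ the set $\tau^{-1}(\mathcal{O}^K_\alpha)$ contains at most $M$ $K$-orbits.
   Context: Write the Hermitian inner product on $V$ as $\langle\cdot,\cdot\rangle=(\cdot,\cdot)+i\,\omega(\cdot,\cdot)$, with $(\cdot,\cdot)$ and $\omega$ its real and imaginary parts. The (unnormalized) moment map $\tau:V\to\mathfrak{k}^*$ is defined by $\tau(z)(A)=\omega(z,Az)$ for $z\in V$, $A\in\mathfrak{k}$, where $(A,z)\mapsto Az$ is the derived action of $\mathfrak{k}$ on $V$. It is $K$-equivariant, $\tau(kz)=\mathrm{Ad}^*(k)\tau(z)$, so it maps $K$-orbits in $V$ to coadjoint orbits $\mathcal{O}^K_\alpha=\mathrm{Ad}^*(K)\alpha$ in $\mathfrak{k}^*$. One says $\tau$ is finite-to-one on $K$-orbits if for every $\alpha\in\mathfrak{k}^*$ the set $\tau^{-1}(\mathcal{O}^K_\alpha)$ is a (possibly empty) finite union of $K$-orbits. *)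

theory Defs
  imports "HOL-Analysis.Analysis" "HOL-Algebra.Group_Action"
begin

section \<open>Smooth manifolds\<close>

text \<open>
  Finite-dimensional real vector spaces are modelled by types of class \<open>real_normed_vector\<close> with a
  finite basis. Unlike \<open>euclidean_space\<close> this admits dimension zero.
\<close>

primrec Ck_on :: "nat \<Rightarrow> 'a set \<Rightarrow> ('a::real_normed_vector \<Rightarrow> 'b::real_normed_vector) \<Rightarrow> bool" where
  "Ck_on 0 S f \<longleftrightarrow> continuous_on S f"
| "Ck_on (Suc k) S f \<longleftrightarrow>
     (\<forall>x\<in>S. f differentiable (at x)) \<and> (\<forall>v. Ck_on k S (\<lambda>x. frechet_derivative f (at x) v))"

text \<open>Only meaningful for open \<open>S\<close>, as derivatives are taken at interior points.\<close>

definition smooth_on :: "'a set \<Rightarrow> ('a::real_normed_vector \<Rightarrow> 'b::real_normed_vector) \<Rightarrow> bool" where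
  "smooth_on S f \<longleftrightarrow> (\<forall>k. Ck_on k S f)"

type_synonym ('m, 'e) chart = "'m set \<times> ('m \<Rightarrow> 'e)"

definition chart_on :: "'m topology \<Rightarrow> ('m, 'e::real_normed_vector) chart \<Rightarrow> bool" where
  "chart_on T c \<longleftrightarrow> (case c of (U, \<phi>) \<Rightarrow>
     openin T U \<and> open (\<phi> ` U) \<and> homeomorphic_map (subtopology T U) (top_of_set (\<phi> ` U)) \<phi>)"

definition smooth_map ::
  "'m topology \<Rightarrow> ('m, 'e::real_normed_vector) chart set \<Rightarrow>
   'n topology \<Rightarrow> ('n, 'f::real_normed_vector) chart set \<Rightarrow> ('m \<Rightarrow> 'n) \<Rightarrow> bool" where
  "smooth_map T \<A> T' \<A>' f \<longleftrightarrow>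
     continuous_map T T' f \<and>
     (\<forall>(U, \<phi>)\<in>\<A>. \<forall>(W, \<psi>)\<in>\<A>'. smooth_on (\<phi> ` (U \<inter> f -` W)) (\<psi> \<circ> f \<circ> inv_into U \<phi>))"

text \<open>Atlases need not be maximal.\<close>

definition smooth_manifold :: "'m topology \<Rightarrow> ('m, 'e::real_normed_vector) chart set \<Rightarrow> bool" where
  "smooth_manifold T \<A> \<longleftrightarrow>
     Hausdorff_space T \<and> second_countable T \<and>
     (\<exists>B. finite_dimensional_vector_space (scaleR :: real \<Rightarrow> 'e \<Rightarrow> 'e) B) \<and>
     (\<forall>c\<in>\<A>. chart_on T c) \<and>
     (\<Union>(U, \<phi>)\<in>\<A>. U) = topspace T \<and>
     (\<forall>(U, \<phi>)\<in>\<A>. \<forall>(W, \<psi>)\<in>\<A>. smooth_on (\<phi> ` (U \<inter> W)) (\<psi> \<circ> inv_into U \<phi>))"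

definition prod_atlas ::
  "('m, 'e) chart set \<Rightarrow> ('n, 'f) chart set \<Rightarrow> ('m \<times> 'n, 'e \<times> 'f) chart set" where
  "prod_atlas \<A> \<B> = {(U \<times> W, map_prod \<phi> \<psi>) |U \<phi> W \<psi>. (U, \<phi>) \<in> \<A> \<and> (W, \<psi>) \<in> \<B>}"

definition vector_space_atlas :: "('e, 'e::real_normed_vector) chart set" where
  "vector_space_atlas = {(UNIV, id)}"

section \<open>Lie groups\<close>

locale lie_group = group G
  for G :: "('k, 'r) monoid_scheme" (structure) +
  fixes T :: "'k topology" and \<A> :: "('k, 'e::real_normed_vector) chart set"
  assumes topspace: "topspace T = carrier G"
    and manifold: "smooth_manifold T \<A>"
    and smooth_mult: "smooth_map (prod_topology T T) (prod_atlas \<A> \<A>) T \<A> (\<lambda>(g, h). g \<otimes> h)"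
    and smooth_inv: "smooth_map T \<A> T \<A> (\<lambda>g. inv g)"

text \<open>
  A chart \<open>(U, \<phi>)\<close> around the identity identifies the Lie algebra, i.e. the tangent space at the
  identity, with the model space \<open>'e\<close>: a vector \<open>A :: 'e\<close> is the velocity at \<open>t = 0\<close> of the curve
  \<open>t \<mapsto> inv_into U \<phi> (\<phi> \<one> + t *\<^sub>R A)\<close>.
  The dual of the Lie algebra is the set of linear functionals on \<open>'e\<close>.
\<close>

definition identity_chart ::
  "('k, 'r) monoid_scheme \<Rightarrow> ('k, 'e::real_normed_vector) chart set \<Rightarrow> ('k, 'e) chart \<Rightarrow> bool" where
  "identity_chart G \<A> c \<longleftrightarrow> c \<in> \<A> \<and> \<one>\<^bsub>G\<^esub> \<in> fst c"

definition lie_algebra_dual :: "('e::real_normed_vector \<Rightarrow> real) set" where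
  "lie_algebra_dual = {\<alpha>. linear \<alpha>}"

definition differential_at_identity ::
  "('k, 'r) monoid_scheme \<Rightarrow> ('k, 'e::real_normed_vector) chart \<Rightarrow>
   ('k \<Rightarrow> 'b::real_normed_vector) \<Rightarrow> 'e \<Rightarrow> 'b" where
  "differential_at_identity G c f =
     (case c of (U, \<phi>) \<Rightarrow> frechet_derivative (f \<circ> inv_into U \<phi>) (at (\<phi> \<one>\<^bsub>G\<^esub>)))"

definition Ad ::
  "('k, 'r) monoid_scheme \<Rightarrow> ('k, 'e::real_normed_vector) chart \<Rightarrow> 'k \<Rightarrow> 'e \<Rightarrow> 'e" where
  "Ad G c k = differential_at_identity G c (\<lambda>g. snd c (k \<otimes>\<^bsub>G\<^esub> g \<otimes>\<^bsub>G\<^esub> inv\<^bsub>G\<^esub> k))"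

definition coAd ::
  "('k, 'r) monoid_scheme \<Rightarrow> ('k, 'e::real_normed_vector) chart \<Rightarrow>
   'k \<Rightarrow> ('e \<Rightarrow> real) \<Rightarrow> ('e \<Rightarrow> real)" where
  "coAd G c k \<alpha> = \<alpha> \<circ> Ad G c (inv\<^bsub>G\<^esub> k)"

section \<open>Unitary representations\<close>

text \<open>
  The real inner product of the type is the real part of the Hermitian one. The Hermitian inner
  product is linear in its first argument; the opposite convention only changes the sign of its
  imaginary part.
\<close>

locale hermitian_space =
  fixes scaleC :: "complex \<Rightarrow> 'v::real_inner \<Rightarrow> 'v"
    and herm :: "'v \<Rightarrow> 'v \<Rightarrow> complex"
  assumes finite_dim: "\<exists>B. finite_dimensional_vector_space scaleC B"
    and scaleC_of_real: "scaleC (complex_of_real r) x = r *\<^sub>R x"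
    and herm_add_left: "herm (x + y) z = herm x z + herm y z"
    and herm_scaleC_left: "herm (scaleC a x) y = a * herm x y"
    and herm_commute: "herm y x = cnj (herm x y)"
    and Re_herm: "Re (herm x y) = x \<bullet> y"

locale unitary_lie_group_rep =
  lie_group G T \<A> + hermitian_space scaleC herm + group_action G UNIV \<rho>
  for G :: "('k, 'r) monoid_scheme" (structure)
    and T :: "'k topology"
    and \<A> :: "('k, 'e::real_normed_vector) chart set"
    and scaleC :: "complex \<Rightarrow> 'v::real_inner \<Rightarrow> 'v"
    and herm :: "'v \<Rightarrow> 'v \<Rightarrow> complex"
    and \<rho> :: "'k \<Rightarrow> 'v \<Rightarrow> 'v" +
  assumes rep_linear: "k \<in> carrier G \<Longrightarrow> Vector_Spaces.linear scaleC scaleC (\<rho> k)"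
    and rep_unitary: "k \<in> carrier G \<Longrightarrow> herm (\<rho> k x) (\<rho> k y) = herm x y"
    and rep_smooth: "smooth_map T \<A> euclidean vector_space_atlas (\<lambda>k. \<rho> k z)"

definition derived_action ::
  "('k, 'r) monoid_scheme \<Rightarrow> ('k, 'e::real_normed_vector) chart \<Rightarrow> ('k \<Rightarrow> 'v \<Rightarrow> 'v) \<Rightarrow>
   'e \<Rightarrow> 'v::real_normed_vector \<Rightarrow> 'v" where
  "derived_action G c \<rho> A z = differential_at_identity G c (\<lambda>k. \<rho> k z) A"

definition moment_map ::
  "('k, 'r) monoid_scheme \<Rightarrow> ('k, 'e::real_normed_vector) chart \<Rightarrow>
   ('v \<Rightarrow> 'v \<Rightarrow> complex) \<Rightarrow> ('k \<Rightarrow> 'v \<Rightarrow> 'v) \<Rightarrow> 'v::real_normed_vector \<Rightarrow> 'e \<Rightarrow> real" where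
  "moment_map G c herm \<rho> z = (\<lambda>A. Im (herm z (derived_action G c \<rho> A z)))"

text \<open>The preimage under the moment map of the coadjoint orbit through \<open>\<alpha>\<close>.\<close>

definition moment_preimage ::
  "('k, 'r) monoid_scheme \<Rightarrow> ('k, 'e::real_normed_vector) chart \<Rightarrow>
   ('v \<Rightarrow> 'v \<Rightarrow> complex) \<Rightarrow> ('k \<Rightarrow> 'v \<Rightarrow> 'v) \<Rightarrow> ('e \<Rightarrow> real) \<Rightarrow> 'v::real_normed_vector set" where
  "moment_preimage G c herm \<rho> \<alpha> = moment_map G c herm \<rho> -` orbit G (coAd G c) \<alpha>"

definition finite_to_one_on_orbits ::
  "('k, 'r) monoid_scheme \<Rightarrow> ('k, 'e::real_normed_vector) chart \<Rightarrow>
   ('v \<Rightarrow> 'v \<Rightarrow> complex) \<Rightarrow> ('k \<Rightarrow> 'v \<Rightarrow> 'v::real_normed_vector) \<Rightarrow> bool" where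
  "finite_to_one_on_orbits G c herm \<rho> \<longleftrightarrow>
     (\<forall>\<alpha>\<in>lie_algebra_dual. \<exists>F. finite F \<and> F \<subseteq> orbits G UNIV \<rho> \<and>
        moment_preimage G c herm \<rho> \<alpha> = \<Union>F)"

definition uniformly_finite_to_one_on_orbits ::
  "('k, 'r) monoid_scheme \<Rightarrow> ('k, 'e::real_normed_vector) chart \<Rightarrow>
   ('v \<Rightarrow> 'v \<Rightarrow> complex) \<Rightarrow> ('k \<Rightarrow> 'v \<Rightarrow> 'v::real_normed_vector) \<Rightarrow> bool" where
  "uniformly_finite_to_one_on_orbits G c herm \<rho> \<longleftrightarrow>
     (\<exists>M::nat. \<forall>\<alpha>\<in>lie_algebra_dual.
        finite {X \<in> orbits G UNIV \<rho>. X \<subseteq> moment_preimage G c herm \<rho> \<alpha>} \<and>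
        card {X \<in> orbits G UNIV \<rho>. X \<subseteq> moment_preimage G c herm \<rho> \<alpha>} \<le> M)"

end

theory Submission
  imports Defs "HOL-Library.Function_Algebras"
begin

text \<open>
  The number of orbits over a coadjoint orbit is bounded by \<open>9 ^ n\<close>, where \<open>n\<close> is the real dimension
  of \<open>V\<close>.

  By equivariance of the moment map \<open>\<tau>\<close> every \<open>K\<close>-orbit in the preimage of the coadjoint orbit of
  \<open>\<alpha>\<close> meets the fibre over \<open>\<alpha>\<close> itself (\<open>moment_preimage_meets_fibre\<close>). This fibre is the zero set of
  \<open>f z = (\<Sum>A. (\<tau> z A - \<alpha> A)\<^sup>2)\<close>, where \<open>A\<close> runs over a finite
  spanning set of the Lie algebra. Since \<open>\<tau> z A\<close> is a quadratic form in \<open>z\<close>, \<open>f\<close> is a nonnegative polynomial of degree at most 4, and neither its degree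
  nor its number of variables depends on \<open>\<alpha>\<close>. If \<open>\<tau>\<close> is finite-to-one on orbits, then this zero set is
  contained in a finite union of disjoint compact sets, the orbits, each of which it meets. So it
  suffices to bound, by a number depending only on the degree and the dimension, into how many
  pieces the zero set of a nonnegative polynomial can be split by disjoint compact sets
  (\<open>card_zero_set_pieces_le\<close>).

  This weak form of the Oleinik-Petrovskii-Milnor-Thom bound has a direct proof. Let \<open>d\<close> be the degree
  of \<open>f\<close>, and perturb \<open>f\<close> to \<open>f x + \<epsilon> * (\<Sum>i. x\<^sub>i ^ (2 * d + 2))\<close>. For small \<open>\<epsilon> > 0\<close> the perturbed
  function has a local minimum near each of the pieces. At a local minimum the partial derivatives
  vanish, that is, \<open>x\<^sub>i ^ (2 * d + 1) = p\<^sub>i x\<close> for each \<open>i\<close>, where \<open>p\<^sub>i\<close> is a polynomial of degree less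
  than \<open>2 * d + 1\<close>. On a finite set \<open>S\<close> of solutions of this system these equations can be used to
  rewrite every polynomial function as a linear combination of the \<open>(2 * d + 1) ^ n\<close> monomials
  with all exponents at most \<open>2 * d\<close>. As every function on a finite set is polynomial, \<open>S\<close> has at most \<open>(2 * d + 1) ^ n\<close>
  elements (\<open>card_diagonal_system_le\<close>).
\<close>

section \<open>Polynomial functions in orthonormal coordinates\<close>

interpretation fun_space: vector_space "\<lambda>c f x. c * f x :: real"
  by unfold_locales (auto simp: fun_eq_iff algebra_simps)

lemma sum_fun_apply: "(\<Sum>i\<in>I. F i) x = (\<Sum>i\<in>I. F i x)"
  for F :: "'i \<Rightarrow> 'a \<Rightarrow> 'b::comm_monoid_add"
  by (induction I rule: infinite_finite_induct) auto

lemma fun_space_sum: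
  assumes "finite I" "\<And>i. i \<in> I \<Longrightarrow> F i \<in> fun_space.span B"
  shows "(\<lambda>x. \<Sum>i\<in>I. F i x :: real) \<in> fun_space.span B"
  using assms
proof (induction I rule: finite_induct)
  case empty
  then show ?case
    using fun_space.span_zero by (simp add: zero_fun_def)
next
  case (insert i I)
  then show ?case
    using fun_space.span_add[of "F i" B "\<lambda>x. \<Sum>i\<in>I. F i x"] by (simp add: plus_fun_def)
qed

text \<open>
  The dimension of the representation space is not tied to a type of class \<open>euclidean_space\<close>, so
  coordinates are inner products with a chosen finite orthonormal set.
\<close>

locale orthonormal_coordinates =
  fixes E :: "'v::real_inner set"
  assumes finite_E: "finite E"
    and orthonormal: "e \<in> E \<Longrightarrow> e' \<in> E \<Longrightarrow> e \<bullet> e' = (if e = e' then 1 else 0)"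
    and span_E: "span E = UNIV"
begin

lemma expansion: "x = (\<Sum>e\<in>E. (x \<bullet> e) *\<^sub>R e)"
proof -
  have "x \<in> span E"
    by (simp add: span_E)
  then show ?thesis
  proof (induction rule: span_induct)
    case base
    show ?case
      by (auto simp: subspace_def inner_add_left scaleR_add_left sum.distrib
          simp flip: scaleR_scaleR scaleR_sum_right)
  next
    case (step e)
    then have "(\<Sum>e'\<in>E. (e \<bullet> e') *\<^sub>R e') = (\<Sum>e'\<in>E. if e = e' then e' else 0)"
      by (intro sum.cong) (auto simp: orthonormal)
    then show ?case
      using step finite_E by simp
  qed
qed

lemma linear_expansion:
  assumes "linear L"
  shows "L x = (\<Sum>e\<in>E. (x \<bullet> e) *\<^sub>R L e)"
proof -
  have "L x = L (\<Sum>e\<in>E. (x \<bullet> e) *\<^sub>R e)"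
    using expansion[of x] by simp
  then show ?thesis
    using assms by (simp add: linear_sum linear_scale)
qed

lemma closed_bounded_compact:
  fixes S :: "'v set"
  assumes "closed S" "bounded S"
  shows "compact S"
proof -
  obtain R where R: "\<And>x. x \<in> S \<Longrightarrow> norm x \<le> R"
    using assms(2) by (auto simp: bounded_iff)
  define box where "box F = {\<Sum>e\<in>F. c e *\<^sub>R e |c. \<forall>e\<in>F. c e \<in> {-R..R}}" for F :: "'v set"
  have "compact (box F)" if "finite F" for F
    using that
  proof (induction F rule: finite_induct)
    case empty
    then show ?case
      by (simp add: box_def)
  next
    case (insert e F)
    have "box (insert e F) = {x + y |x y. x \<in> (\<lambda>t. t *\<^sub>R e) ` {-R..R} \<and> y \<in> box F}"
      (is "?l = ?r")
    proof (intro equalityI subsetI)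
      fix x assume "x \<in> ?l"
      then show "x \<in> ?r"
        using insert by (fastforce simp: box_def)
    next
      fix x assume "x \<in> ?r"
      then obtain t c where tc: "t \<in> {-R..R}" "\<forall>e\<in>F. c e \<in> {-R..R}"
        "x = t *\<^sub>R e + (\<Sum>e\<in>F. c e *\<^sub>R e)"
        by (auto simp: box_def)
      have "(\<Sum>e'\<in>F. (c(e := t)) e' *\<^sub>R e') = (\<Sum>e\<in>F. c e *\<^sub>R e)"
        using insert by (intro sum.cong) auto
      then have "x = (\<Sum>e'\<in>insert e F. (c(e := t)) e' *\<^sub>R e')"
        using insert tc by simp
      moreover have "\<forall>e'\<in>insert e F. (c(e := t)) e' \<in> {-R..R}"
        using tc by auto
      ultimately show "x \<in> ?l"
        unfolding box_def by blast
    qed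
    moreover have "compact ((\<lambda>t. t *\<^sub>R e) ` {-R..R})"
      by (intro compact_continuous_image continuous_intros compact_Icc)
    then have "compact {x + y |x y. x \<in> (\<lambda>t. t *\<^sub>R e) ` {-R..R} \<and> y \<in> box F}"
      using insert by (intro compact_sums)
    ultimately show ?case
      by simp
  qed
  then have "compact (box E)"
    using finite_E by simp
  moreover have "S \<subseteq> box E"
  proof
    fix x assume "x \<in> S"
    have "\<forall>e\<in>E. x \<bullet> e \<in> {-R..R}"
    proof
      fix e assume "e \<in> E"
      then have "norm e = 1"
        using orthonormal[of e e] by (simp add: norm_eq_sqrt_inner)
      then have "\<bar>x \<bullet> e\<bar> \<le> R"
        using Cauchy_Schwarz_ineq2[of x e] R[OF \<open>x \<in> S\<close>] by simp
      then show "x \<bullet> e \<in> {-R..R}"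
        by auto
    qed
    then show "x \<in> box E"
      using expansion[of x] unfolding box_def by blast
  qed
  ultimately show ?thesis
    using assms(1) by (metis compact_Int_closed inf.absorb_iff2)
qed

definition monomial :: "('v \<Rightarrow> nat) \<Rightarrow> 'v \<Rightarrow> real" where
  "monomial \<beta> x = (\<Prod>e\<in>E. (x \<bullet> e) ^ \<beta> e)"

text \<open>
  The space is a linear span, so that dimension arguments apply to it directly. The index bounds the
  degree, hence the spaces are nested.
\<close>

definition polynomials :: "nat \<Rightarrow> ('v \<Rightarrow> real) set" where
  "polynomials d = fun_space.span {monomial \<beta> |\<beta>. sum \<beta> E \<le> d}"

lemma monomial_in_polynomials: "sum \<beta> E \<le> d \<Longrightarrow> monomial \<beta> \<in> polynomials d"
  unfolding polynomials_def by (intro fun_space.span_base) blast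

lemma monomial_mult: "monomial \<beta> x * monomial \<gamma> x = monomial (\<lambda>e. \<beta> e + \<gamma> e) x"
  by (simp add: monomial_def power_add prod.distrib)

lemma polynomials_mono: "d \<le> d' \<Longrightarrow> polynomials d \<subseteq> polynomials d'"
  unfolding polynomials_def by (intro fun_space.span_mono) auto

lemma polynomials_add:
  "f \<in> polynomials d \<Longrightarrow> g \<in> polynomials d \<Longrightarrow> (\<lambda>x. f x + g x) \<in> polynomials d"
  unfolding polynomials_def using fun_space.span_add by (fastforce simp: plus_fun_def)

lemma polynomials_scale: "f \<in> polynomials d \<Longrightarrow> (\<lambda>x. c * f x) \<in> polynomials d"
  unfolding polynomials_def by (rule fun_space.span_scale)

lemma polynomials_sum:
  "finite I \<Longrightarrow> (\<And>i. i \<in> I \<Longrightarrow> F i \<in> polynomials d) \<Longrightarrow> (\<lambda>x. \<Sum>i\<in>I. F i x) \<in> polynomials d"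
  unfolding polynomials_def by (rule fun_space_sum)

lemma polynomials_const: "(\<lambda>x. c) \<in> polynomials d"
  using polynomials_scale[OF monomial_in_polynomials[of "\<lambda>e. 0" d], of c]
  by (simp add: monomial_def)

lemma polynomials_inner: "e \<in> E \<Longrightarrow> (\<lambda>x. x \<bullet> e) \<in> polynomials 1"
proof -
  assume e: "e \<in> E"
  have "monomial (\<lambda>e'. if e' = e then 1 else 0) = (\<lambda>x. x \<bullet> e)"
    using e finite_E by (auto simp: monomial_def fun_eq_iff if_distrib prod.delta cong: if_cong)
  moreover have "(\<Sum>e'\<in>E. if e' = e then 1 else 0) \<le> (1::nat)"
    using e finite_E by simp
  ultimately show ?thesis
    by (metis (no_types, lifting) monomial_in_polynomials)
qed

lemma polynomials_linear:
  assumes "linear L"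
  shows "L \<in> polynomials 1"
proof -
  have "(\<lambda>x. \<Sum>e\<in>E. L e * (x \<bullet> e)) \<in> polynomials 1"
    by (intro polynomials_sum polynomials_scale polynomials_inner finite_E)
  moreover have "L = (\<lambda>x. \<Sum>e\<in>E. L e * (x \<bullet> e))"
    by (rule ext) (use linear_expansion[OF assms] in \<open>metis (no_types, lifting) mult.commute
        real_scaleR_def sum.cong\<close>)
  ultimately show ?thesis
    by simp
qed

lemma polynomials_induct [consumes 1, case_names zero add monomial]:
  assumes "f \<in> polynomials d"
    and "P (\<lambda>x. 0)"
    and "\<And>c \<beta> g. sum \<beta> E \<le> d \<Longrightarrow> g \<in> polynomials d \<Longrightarrow> P g \<Longrightarrow> P (\<lambda>x. c * monomial \<beta> x + g x)"
  shows "P f"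
proof -
  have "f \<in> polynomials d \<and> P f"
    using assms(1) unfolding polynomials_def
  proof (induction rule: fun_space.span_induct_alt)
    case base
    show ?case
      using assms(2) by (simp add: zero_fun_def fun_space.span_zero[unfolded zero_fun_def])
  next
    case (step c m g)
    then obtain \<beta> where \<beta>: "m = monomial \<beta>" "sum \<beta> E \<le> d"
      by blast
    have "(\<lambda>x. c * monomial \<beta> x + g x) \<in> polynomials d"
      using step \<beta> by (intro polynomials_add polynomials_scale monomial_in_polynomials)
        (auto simp: polynomials_def)
    then show ?case
      using step \<beta> assms(3)[of \<beta> g c] by (simp add: plus_fun_def polynomials_def)
  qed
  then show ?thesis ..
qed

lemma polynomials_mult:
  assumes "f \<in> polynomials d" "g \<in> polynomials d'"
  shows "(\<lambda>x. f x * g x) \<in> polynomials (d + d')"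
  using assms(1)
proof (induction rule: polynomials_induct)
  case zero
  show ?case
    using polynomials_const[of 0] by simp
next
  case (add c \<beta> f)
  have "(\<lambda>x. monomial \<beta> x * g x) \<in> polynomials (d + d')"
    using assms(2)
  proof (induction rule: polynomials_induct)
    case zero
    show ?case
      using polynomials_const[of 0] by simp
  next
    case (add c \<gamma> g)
    have "(\<lambda>x. c * monomial (\<lambda>e. \<beta> e + \<gamma> e) x + monomial \<beta> x * g x) \<in> polynomials (d + d')"
      using add \<open>sum \<beta> E \<le> d\<close>
      by (intro polynomials_add polynomials_scale monomial_in_polynomials) (auto simp: sum.distrib)
    then show ?case
      by (simp add: algebra_simps flip: monomial_mult)
  qed
  from polynomials_add[OF polynomials_scale[OF this, of c] add.IH] show ?case
    by (simp add: algebra_simps)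
qed

lemma polynomials_square: "f \<in> polynomials d \<Longrightarrow> (\<lambda>x. (f x)\<^sup>2) \<in> polynomials (2 * d)"
  using polynomials_mult[of f d f d] by (simp add: power2_eq_square mult_2)

lemma continuous_on_polynomial: "f \<in> polynomials d \<Longrightarrow> continuous_on S f"
proof (induction rule: polynomials_induct)
  case (add c \<beta> g)
  then show ?case
    unfolding monomial_def
    by (intro continuous_on_add continuous_on_mult continuous_on_const continuous_on_prod
        continuous_on_power continuous_on_inner continuous_on_id)
qed (rule continuous_on_const)

lemma DERIV_monomial:
  assumes "b \<in> E"
  shows "((\<lambda>t. monomial \<beta> (x + t *\<^sub>R b)) has_real_derivative
    real (\<beta> b) * monomial (\<beta>(b := \<beta> b - 1)) x) (at 0)"
proof -
  define rest where "rest = (\<Prod>e\<in>E - {b}. (x \<bullet> e) ^ \<beta> e)"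
  have rest: "monomial \<gamma> y = (y \<bullet> b) ^ \<gamma> b * rest"
    if "\<And>e. e \<in> E - {b} \<Longrightarrow> \<gamma> e = \<beta> e \<and> y \<bullet> e = x \<bullet> e" for \<gamma> y
    using that assms finite_E by (simp add: monomial_def rest_def prod.remove[of E b])
  have "monomial \<beta> (x + t *\<^sub>R b) = (x \<bullet> b + t) ^ \<beta> b * rest" for t
    using assms by (subst rest[of \<beta>]) (auto simp: inner_add_left orthonormal)
  moreover have "monomial (\<beta>(b := \<beta> b - 1)) x = (x \<bullet> b) ^ (\<beta> b - 1) * rest"
    by (subst rest[of "\<beta>(b := \<beta> b - 1)" x]) auto
  moreover have "((\<lambda>t. (x \<bullet> b + t) ^ \<beta> b * rest) has_real_derivative
      real (\<beta> b) * ((x \<bullet> b) ^ (\<beta> b - 1) * rest)) (at 0)"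
    by (auto intro!: derivative_eq_intros)
  ultimately show ?thesis
    by (simp only:)
qed

text \<open>
  The degree of a partial derivative is one lower, but bounding it by \<open>d\<close> avoids an exception for
  \<open>d = 0\<close> and is good enough: the partial derivatives of the perturbing power sum have larger degree anyway.
\<close>

lemma polynomial_has_partial_derivative:
  assumes "f \<in> polynomials d" "b \<in> E"
  shows "\<exists>f'\<in>polynomials d. \<forall>x. ((\<lambda>t. f (x + t *\<^sub>R b)) has_real_derivative f' x) (at 0)"
  using assms(1)
proof (induction rule: polynomials_induct)
  case zero
  show ?case
    by (intro bexI[of _ "\<lambda>x. 0"] allI DERIV_const polynomials_const)
next
  case (add c \<beta> g)
  from add.IH obtain g' where g': "g' \<in> polynomials d"
    "\<forall>x. ((\<lambda>t. g (x + t *\<^sub>R b)) has_real_derivative g' x) (at 0)"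
    by (rule bexE)
  define f' where "f' = (\<lambda>x. c * (real (\<beta> b) * monomial (\<beta>(b := \<beta> b - 1)) x) + g' x)"
  have "sum (\<beta>(b := \<beta> b - 1)) E \<le> sum \<beta> E"
    by (intro sum_mono) auto
  then have "f' \<in> polynomials d"
    unfolding f'_def
    using g'(1) add(1) by (intro polynomials_add polynomials_scale monomial_in_polynomials) simp_all
  moreover have "((\<lambda>t. c * monomial \<beta> (x + t *\<^sub>R b) + g (x + t *\<^sub>R b)) has_real_derivative f' x)
      (at 0)" for x
    unfolding f'_def
    by (rule DERIV_add[OF DERIV_cmult[OF DERIV_monomial[OF assms(2)]] g'(2)[rule_format]])
  ultimately show ?case
    by (intro bexI[of _ f'] allI)
qed

section \<open>Counting the solutions of a system with diagonal leading terms\<close>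

definition reduced_exponents :: "nat \<Rightarrow> ('v \<Rightarrow> nat) set" where
  "reduced_exponents k = PiE E (\<lambda>_. {..<k})"

lemma monomial_restrict: "monomial (restrict \<beta> E) = monomial \<beta>"
  by (auto simp: monomial_def fun_eq_iff)

text \<open>
  A monomial with an exponent greater than \<open>k\<close> contains a factor \<open>(x \<bullet> e) ^ Suc k\<close>, which on \<open>S\<close> may be
  replaced by a polynomial of smaller degree. Induction on the degree ends with monomials all of
  whose exponents are at most \<open>k\<close>. The factor \<open>indicator S\<close> expresses equality on \<open>S\<close> only as an
  equality of functions on the whole space.
\<close>

lemma polynomial_reduction:
  assumes p: "\<And>e. e \<in> E \<Longrightarrow> p e \<in> polynomials k"
    and S: "\<And>x e. x \<in> S \<Longrightarrow> e \<in> E \<Longrightarrow> (x \<bullet> e) ^ Suc k = p e x"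
    and "f \<in> polynomials d"
  shows "(\<lambda>x. indicator S x * f x) \<in>
    fun_space.span ((\<lambda>\<beta> x. indicator S x * monomial \<beta> x) ` reduced_exponents (Suc k))"
    (is "_ \<in> ?R")
  using assms(3)
proof (induction d arbitrary: f rule: less_induct)
  case (less d)
  have monom: "(\<lambda>x. indicator S x * monomial \<beta> x) \<in> ?R" if \<beta>: "sum \<beta> E \<le> d" for \<beta>
  proof (cases "\<exists>b\<in>E. \<beta> b > k")
    case False
    then have "restrict \<beta> E \<in> reduced_exponents (Suc k)"
      by (auto simp: reduced_exponents_def less_Suc_eq_le not_less)
    then show ?thesis
      using monomial_restrict[of \<beta>]
      by (intro fun_space.span_base image_eqI[of _ _ "restrict \<beta> E"]) auto
  next
    case True
    then obtain b where b: "b \<in> E" "\<beta> b > k"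
      by blast
    \<comment> \<open>\<open>\<gamma>\<close> is what remains of the monomial once the power
      \<open>(x \<bullet> b) ^ Suc k\<close> is split off\<close>
    define \<gamma> where "\<gamma> = \<beta>(b := \<beta> b - Suc k)"
    have "sum \<beta> E = \<beta> b + sum \<beta> (E - {b})" "sum \<gamma> E = \<gamma> b + sum \<gamma> (E - {b})"
      using b finite_E by (simp_all add: sum.remove)
    moreover have "sum \<gamma> (E - {b}) = sum \<beta> (E - {b})"
      by (intro sum.cong) (auto simp: \<gamma>_def)
    ultimately have deg: "sum \<gamma> E + k < d"
      using \<beta> b by (simp add: \<gamma>_def)
    have "(\<lambda>x. monomial \<gamma> x * p b x) \<in> polynomials (sum \<gamma> E + k)"
      using b by (intro polynomials_mult monomial_in_polynomials p) auto
    then have "(\<lambda>x. indicator S x * (monomial \<gamma> x * p b x)) \<in> ?R"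
      using less.IH[OF deg] by simp
    moreover have "indicator S x * monomial \<beta> x = indicator S x * (monomial \<gamma> x * p b x)" for x
    proof (cases "x \<in> S")
      case True
      have "(x \<bullet> b) ^ \<beta> b = (x \<bullet> b) ^ \<gamma> b * (x \<bullet> b) ^ Suc k"
        using b by (simp add: \<gamma>_def flip: power_add power_Suc)
      moreover have "(\<Prod>e\<in>E - {b}. (x \<bullet> e) ^ \<gamma> e) = (\<Prod>e\<in>E - {b}. (x \<bullet> e) ^ \<beta> e)"
        by (intro prod.cong) (auto simp: \<gamma>_def)
      ultimately show ?thesis
        using S[OF True b(1)] b finite_E by (simp add: monomial_def prod.remove[of E b])
    qed simp
    ultimately show ?thesis
      by (simp only:)
  qed
  from less.prems show ?case
  proof (induction rule: polynomials_induct)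
    case zero
    show ?case
      using fun_space.span_zero by (simp add: zero_fun_def)
  next
    case (add c \<beta> g)
    from fun_space.span_add[OF fun_space.span_scale[OF monom[OF add(1)], of c] add.IH]
    show ?case
      by (simp add: plus_fun_def algebra_simps)
  qed
qed

lemma interpolation:
  assumes "finite S" "s \<in> S"
  obtains d f where "f \<in> polynomials d" "f s = 1" "\<And>t. t \<in> S \<Longrightarrow> t \<noteq> s \<Longrightarrow> f t = 0"
proof -
  have "\<exists>d. \<exists>f\<in>polynomials d. f s = 1 \<and> (\<forall>t\<in>F. f t = 0)" if "finite F" "s \<notin> F" for F
    using that
  proof (induction F rule: finite_induct)
    case empty
    show ?case
      by (intro exI[of _ 0] bexI[of _ "\<lambda>x. 1"] polynomials_const) auto
  next
    case (insert t F)
    then obtain d f where f: "f \<in> polynomials d" "f s = 1" "\<forall>t\<in>F. f t = 0"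
      by auto
    \<comment> \<open>an affine function with value 1 at \<open>s\<close> and 0 at \<open>t\<close>; the product of these
      over all \<open>t\<close> interpolates\<close>
    define l where "l x = (1 / ((s - t) \<bullet> (s - t))) * (x \<bullet> (s - t) + - (t \<bullet> (s - t)))" for x
    have "linear (\<lambda>x. x \<bullet> (s - t))"
      by (intro linearI) (auto simp: inner_add_left)
    then have "l \<in> polynomials 1"
      unfolding l_def
      by (intro polynomials_scale polynomials_add polynomials_linear polynomials_const)
    moreover have "l t = 0"
      by (simp add: l_def)
    moreover have "(s - t) \<bullet> (s - t) \<noteq> 0"
      using insert by auto
    then have "l s = 1"
      by (simp add: l_def inner_diff_left)
    ultimately show ?case
      using f by (intro exI[of _ "d + 1"] bexI[of _ "\<lambda>x. f x * l x"] polynomials_mult) auto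
  qed
  from this[of "S - {s}"] obtain d f
    where "f \<in> polynomials d" "f s = 1" "\<forall>t\<in>S - {s}. f t = 0"
    using assms by auto
  then show ?thesis
    by (intro that[of f d]) auto
qed

text \<open>
  The functions on \<open>S\<close> form a space of dimension \<open>card S\<close>. By interpolation each of them is
  polynomial, and by reduction it is a combination of \<open>Suc k ^ card E\<close> monomials.
\<close>

lemma card_diagonal_system_le:
  assumes "finite S"
    and "\<And>e. e \<in> E \<Longrightarrow> p e \<in> polynomials k"
    and "\<And>x e. x \<in> S \<Longrightarrow> e \<in> E \<Longrightarrow> (x \<bullet> e) ^ Suc k = p e x"
  shows "card S \<le> Suc k ^ card E"
proof -
  let ?\<delta> = "\<lambda>s. indicator {s} :: 'v \<Rightarrow> real"
  let ?B = "(\<lambda>\<beta> x. indicator S x * monomial \<beta> x) ` reduced_exponents (Suc k)"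
  have fin: "finite (reduced_exponents (Suc k))"
    unfolding reduced_exponents_def using finite_E by (intro finite_PiE) auto
  have "?\<delta> s \<in> fun_space.span ?B" if s: "s \<in> S" for s
  proof -
    obtain d f where f: "f \<in> polynomials d" "f s = 1" "\<And>t. t \<in> S \<Longrightarrow> t \<noteq> s \<Longrightarrow> f t = 0"
      using interpolation[OF assms(1) s] by metis
    have "?\<delta> s = (\<lambda>x. indicator S x * f x)"
      using f s by (auto simp: fun_eq_iff indicator_def)
    then show ?thesis
      using polynomial_reduction[OF assms(2,3) f(1)] by simp
  qed
  moreover have inj: "inj_on ?\<delta> S"
  proof (rule inj_onI)
    fix s t :: 'v assume "?\<delta> s = ?\<delta> t"
    from fun_cong[OF this, of s] show "s = t"
      by (simp add: indicator_def split: if_splits)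
  qed
  moreover have "fun_space.independent (?\<delta> ` S)"
  proof
    assume "fun_space.dependent (?\<delta> ` S)"
    then obtain u s where us: "s \<in> S" "u (?\<delta> s) \<noteq> 0"
      and "(\<Sum>w\<in>?\<delta> ` S. (\<lambda>x. u w * w x)) = 0"
      using assms(1) by (auto simp: fun_space.dependent_finite)
    then have "(\<Sum>t\<in>S. (\<lambda>x. u (?\<delta> t) * ?\<delta> t x)) = 0"
      using inj by (simp add: sum.reindex)
    from fun_cong[OF this, of s] have "(\<Sum>t\<in>S. u (?\<delta> t) * ?\<delta> t s) = 0"
      by (simp only: sum_fun_apply zero_fun_apply)
    moreover have "(\<Sum>t\<in>S. u (?\<delta> t) * ?\<delta> t s) = (\<Sum>t\<in>S. if t = s then u (?\<delta> s) else 0)"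
      by (intro sum.cong) (auto simp: indicator_def)
    ultimately show False
      using us assms(1) by simp
  qed
  ultimately have "card (?\<delta> ` S) \<le> card ?B"
    using fun_space.independent_span_bound[of ?B "?\<delta> ` S"] fin by (simp add: image_subset_iff)
  also have "\<dots> \<le> card (reduced_exponents (Suc k))"
    by (intro card_image_le fin)
  also have "\<dots> = Suc k ^ card E"
    unfolding reduced_exponents_def using finite_E by (simp add: card_PiE)
  finally show ?thesis
    using inj by (simp add: card_image)
qed

end

section \<open>Counting the components of a zero set\<close>

lemma le_infdist:
  assumes "X \<noteq> {}" "\<And>a. a \<in> X \<Longrightarrow> c \<le> dist x a"
  shows "c \<le> infdist x X"
  using assms by (auto simp: infdist_notempty intro: cINF_greatest)

lemma eventually_disjoint_neighbourhoods:
  assumes "compact X" "X \<noteq> {}" "closed Y" "Y \<noteq> {}" "X \<inter> Y = {}"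
  shows "\<forall>\<^sub>F r in at_right 0. \<forall>x. infdist x X \<le> r \<longrightarrow> r < infdist x Y"
proof -
  have "continuous_on X (\<lambda>x. infdist x Y)"
    by (intro continuous_intros)
  then obtain a where a: "a \<in> X" "\<And>x. x \<in> X \<Longrightarrow> infdist a Y \<le> infdist x Y"
    using continuous_attains_inf[of X "\<lambda>x. infdist x Y"] assms by auto
  have pos: "infdist a Y > 0"
    using assms a by (intro infdist_pos_not_in_closed) auto
  \<comment> \<open>if both distances were at most a third of the gap, the triangle inequality would give \<open>x\<close> a
    distance of at least two thirds of the gap from \<open>X\<close>\<close>
  have "r < infdist x Y" if r: "0 < r" "r < infdist a Y / 3" and x: "infdist x X \<le> r" for r x
  proof (rule ccontr)
    assume "\<not> r < infdist x Y"
    moreover have "infdist a Y \<le> infdist x Y + dist b x" if "b \<in> X" for b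
      using a(2)[OF that] infdist_triangle[of b Y x] by linarith
    ultimately have "2 * r \<le> infdist x X"
      using r assms(2) by (intro le_infdist) (force simp: dist_commute)+
    then show False
      using x r by linarith
  qed
  then show ?thesis
    using pos unfolding eventually_at_right_field
    by (intro exI[of _ "infdist a Y / 3"]) simp
qed

context orthonormal_coordinates
begin

lemma compact_neighbourhood:
  fixes X :: "'v set"
  assumes "compact X" "X \<noteq> {}"
  shows "compact {x. infdist x X \<le> r}"
proof (rule closed_bounded_compact)
  show "closed {x. infdist x X \<le> r}"
    by (intro closed_Collect_le continuous_intros)
  obtain R where R: "\<And>a. a \<in> X \<Longrightarrow> norm a \<le> R"
    using compact_imp_bounded[OF assms(1)] by (auto simp: bounded_iff)
  have "norm x - R \<le> infdist x X" for x
  proof (rule le_infdist[OF assms(2)])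
    fix a assume "a \<in> X"
    then show "norm x - R \<le> dist x a"
      using R[of a] norm_triangle_ineq2[of x a] by (simp add: dist_norm)
  qed
  then have "norm x \<le> r + R" if "infdist x X \<le> r" for x
    using that by (smt (verit))
  then show "bounded {x. infdist x X \<le> r}"
    by (auto simp: bounded_iff)
qed

text \<open>
  On the boundary of the neighbourhood \<open>f\<close> is bounded below by some \<open>\<delta> > 0\<close>, whereas the perturbed
  function takes the value \<open>\<epsilon> * h z < \<delta>\<close> at the zero \<open>z\<close> of \<open>f\<close>. So its minimum over the compact
  neighbourhood lies in the interior.
\<close>

lemma eventually_perturbation_has_minimum:
  fixes X :: "'v set"
  assumes "compact X" "z \<in> X" "f z = 0"
    and "continuous_on UNIV f" "continuous_on UNIV h" "\<And>x. h x \<ge> 0"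
    and shell: "\<And>x. infdist x X = r \<Longrightarrow> f x > (0::real)" and "r > 0"
  shows "\<forall>\<^sub>F \<epsilon> in at_right 0. \<exists>m. infdist m X < r \<and>
    (\<forall>y. infdist y X < r \<longrightarrow> f m + \<epsilon> * h m \<le> f y + \<epsilon> * h y)"
proof -
  let ?N = "{x. infdist x X \<le> r}" and ?B = "{x. infdist x X = r}"
  have N: "compact ?N"
    using assms by (intro compact_neighbourhood) auto
  have "closed ?B"
    by (intro closed_Collect_eq continuous_intros)
  then have B: "compact ?B"
    by (rule closed_bounded_compact[OF _ bounded_subset[OF compact_imp_bounded[OF N]]]) auto
  have "\<exists>\<delta>>0. \<forall>x\<in>?B. \<delta> \<le> f x"
  proof (cases "?B = {}")
    case False
    then obtain b where "b \<in> ?B" "\<forall>x\<in>?B. f b \<le> f x"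
      using continuous_attains_inf[OF B, of f] continuous_on_subset[OF assms(4)] by auto
    then show ?thesis
      using shell by auto
  qed (use zero_less_one in blast)
  then obtain \<delta> where \<delta>: "\<delta> > 0" "\<And>x. infdist x X = r \<Longrightarrow> \<delta> \<le> f x"
    by auto
  have "\<exists>m. infdist m X < r \<and> (\<forall>y. infdist y X < r \<longrightarrow> f m + \<epsilon> * h m \<le> f y + \<epsilon> * h y)"
    if \<epsilon>: "\<epsilon> > 0" "\<epsilon> < \<delta> / (h z + 1)" for \<epsilon>
  proof -
    have z: "z \<in> ?N"
      using assms by auto
    have "continuous_on ?N (\<lambda>x. f x + \<epsilon> * h x)"
      using assms by (intro continuous_intros) (auto intro: continuous_on_subset)
    then obtain m where m: "m \<in> ?N" "\<And>y. y \<in> ?N \<Longrightarrow> f m + \<epsilon> * h m \<le> f y + \<epsilon> * h y"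
      using continuous_attains_inf[OF N, of "\<lambda>x. f x + \<epsilon> * h x"] z by auto
    have "\<epsilon> * (h z + 1) < \<delta>"
      using \<epsilon> assms(6)[of z] by (simp add: pos_less_divide_eq)
    then have "f m + \<epsilon> * h m < \<delta>"
      using m(2)[OF z] \<epsilon> assms(3) by (simp add: algebra_simps)
    moreover have "\<epsilon> * h m \<ge> 0"
      using \<epsilon> assms(6) by simp
    ultimately have "infdist m X \<noteq> r"
      using \<delta>(2)[of m] by auto
    then show ?thesis
      using m by (intro exI[of _ m]) auto
  qed
  moreover have "\<delta> / (h z + 1) > 0"
    using \<delta> assms(6)[of z] by simp
  ultimately show ?thesis
    unfolding eventually_at_right_field by blast
qed

definition power_sum :: "nat \<Rightarrow> 'v \<Rightarrow> real" where
  "power_sum n x = (\<Sum>e\<in>E. (x \<bullet> e) ^ n)"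

lemma DERIV_power_sum:
  assumes "b \<in> E"
  shows "((\<lambda>t. power_sum n (x + t *\<^sub>R b)) has_real_derivative real n * (x \<bullet> b) ^ (n - 1)) (at 0)"
proof -
  have "power_sum n (x + t *\<^sub>R b) = (x \<bullet> b + t) ^ n + (\<Sum>e\<in>E - {b}. (x \<bullet> e) ^ n)" for t
  proof -
    have "(\<Sum>e\<in>E - {b}. ((x + t *\<^sub>R b) \<bullet> e) ^ n) = (\<Sum>e\<in>E - {b}. (x \<bullet> e) ^ n)"
      using assms by (intro sum.cong) (auto simp: inner_add_left orthonormal)
    then show ?thesis
      using assms finite_E
      by (simp add: power_sum_def sum.remove[of E b] inner_add_left orthonormal)
  qed
  moreover have "((\<lambda>t. (x \<bullet> b + t) ^ n + (\<Sum>e\<in>E - {b}. (x \<bullet> e) ^ n)) has_real_derivative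
      real n * (x \<bullet> b) ^ (n - 1)) (at 0)"
    by (auto intro!: derivative_eq_intros)
  ultimately show ?thesis
    by (simp only:)
qed

text \<open>
  The local minima belonging to different pieces lie in disjoint neighbourhoods, hence are distinct,
  and all of them solve the same system with diagonal leading terms.
\<close>

theorem card_zero_set_pieces_le:
  fixes \<X> :: "'v set set"
  assumes f: "f \<in> polynomials d" "\<And>x. f x \<ge> 0"
    and \<X>: "finite \<X>" "\<And>X. X \<in> \<X> \<Longrightarrow> compact X" "disjoint \<X>"
    and zeros: "\<And>x. f x = 0 \<Longrightarrow> x \<in> \<Union>\<X>" "\<And>X. X \<in> \<X> \<Longrightarrow> \<exists>z\<in>X. f z = 0"
  shows "card \<X> \<le> (2 * d + 1) ^ card E"
proof -
  have nonempty: "X \<noteq> {}" if "X \<in> \<X>" for X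
    using zeros(2)[OF that] by blast
  have "\<forall>\<^sub>F r in at_right 0. r > (0::real)"
    by (simp add: eventually_at_right_less)
  moreover have "\<forall>\<^sub>F r in at_right 0. \<forall>X\<in>\<X>. \<forall>Y\<in>\<X> - {X}. \<forall>x. infdist x X \<le> r \<longrightarrow> r < infdist x Y"
    using \<X> nonempty
    by (intro eventually_ball_finite ballI eventually_disjoint_neighbourhoods)
      (auto simp: compact_imp_closed disjoint_def)
  ultimately have "\<forall>\<^sub>F r in at_right 0. r > 0 \<and>
      (\<forall>X\<in>\<X>. \<forall>Y\<in>\<X> - {X}. \<forall>x. infdist x X \<le> r \<longrightarrow> r < infdist x Y)"
    by (rule eventually_conj)
  from eventually_happens'[OF trivial_limit_at_right_real this] obtain r where
    "r > 0" and sep: "\<forall>X\<in>\<X>. \<forall>Y\<in>\<X> - {X}. \<forall>x. infdist x X \<le> r \<longrightarrow> r < infdist x Y"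
    by (elim exE conjE)
  have r: "r < infdist x Y" if "X \<in> \<X>" "Y \<in> \<X>" "X \<noteq> Y" "infdist x X \<le> r" for X Y x
    using sep that by simp
  \<comment> \<open>the exponent is even to make \<open>h\<close> nonnegative, and large enough for the partial derivatives
    of \<open>h\<close> to dominate those of \<open>f\<close> in degree\<close>
  define h where "h = power_sum (2 * d + 2)"
  have h: "continuous_on UNIV h" "\<And>x. h x \<ge> 0"
    unfolding h_def power_sum_def by (intro continuous_intros) (intro sum_nonneg zero_le_even_power, simp)
  have "\<forall>\<^sub>F \<epsilon> in at_right 0. \<forall>X\<in>\<X>. \<exists>m. infdist m X < r \<and>
    (\<forall>y. infdist y X < r \<longrightarrow> f m + \<epsilon> * h m \<le> f y + \<epsilon> * h y)"
  proof (intro eventually_ball_finite ballI \<X>(1))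
    fix X assume X: "X \<in> \<X>"
    obtain z where z: "z \<in> X" "f z = 0"
      using zeros(2)[OF X] by blast
    have "f x > 0" if x: "infdist x X = r" for x
    proof -
      have "x \<notin> Y" if Y: "Y \<in> \<X>" for Y
      proof
        assume "x \<in> Y"
        then have "infdist x Y = 0"
          by simp
        then show False
          using \<open>r > 0\<close> r[OF X Y, of x] x by (cases "X = Y") auto
      qed
      then have "f x \<noteq> 0"
        using zeros(1) by blast
      then show ?thesis
        using f(2)[of x] by simp
    qed
    then show "\<forall>\<^sub>F \<epsilon> in at_right 0. \<exists>m. infdist m X < r \<and>
        (\<forall>y. infdist y X < r \<longrightarrow> f m + \<epsilon> * h m \<le> f y + \<epsilon> * h y)"
      using \<X>(2)[OF X] z h \<open>r > 0\<close> continuous_on_polynomial[OF f(1)]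
      by (intro eventually_perturbation_has_minimum)
  qed
  moreover have "\<forall>\<^sub>F \<epsilon> in at_right 0. \<epsilon> > (0::real)"
    by (simp add: eventually_at_right_less)
  ultimately have "\<forall>\<^sub>F \<epsilon> in at_right 0. (\<forall>X\<in>\<X>. \<exists>m. infdist m X < r \<and>
    (\<forall>y. infdist y X < r \<longrightarrow> f m + \<epsilon> * h m \<le> f y + \<epsilon> * h y)) \<and> \<epsilon> > 0"
    by (rule eventually_conj)
  from eventually_happens'[OF trivial_limit_at_right_real this] obtain \<epsilon> where
    "\<epsilon> > 0" and "\<forall>X\<in>\<X>. \<exists>m. infdist m X < r \<and>
      (\<forall>y. infdist y X < r \<longrightarrow> f m + \<epsilon> * h m \<le> f y + \<epsilon> * h y)"
    by (elim exE conjE)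
  then obtain m where m: "\<And>X. X \<in> \<X> \<Longrightarrow> infdist (m X) X < r"
    "\<And>X y. X \<in> \<X> \<Longrightarrow> infdist y X < r \<Longrightarrow> f (m X) + \<epsilon> * h (m X) \<le> f y + \<epsilon> * h y"
    by metis
  have "inj_on m \<X>"
  proof (rule inj_onI, rule ccontr)
    fix X Y assume "X \<in> \<X>" "Y \<in> \<X>" "m X = m Y" "X \<noteq> Y"
    then show False
      using r[of X Y "m X"] m(1)[of X] m(1)[of Y] by simp
  qed
  then have "card \<X> = card (m ` \<X>)"
    by (simp add: card_image)
  also have "\<dots> \<le> Suc (2 * d) ^ card E"
  proof -
    obtain f' where f': "\<And>b. b \<in> E \<Longrightarrow> f' b \<in> polynomials d"
      "\<And>b x. b \<in> E \<Longrightarrow> ((\<lambda>t. f (x + t *\<^sub>R b)) has_real_derivative f' b x) (at 0)"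
      using polynomial_has_partial_derivative[OF f(1)] by metis
    \<comment> \<open>the right-hand side of
      \<open>f' b x + \<epsilon> * (2 * d + 2) * (x \<bullet> b) ^ (2 * d + 1) = 0\<close> solved for the power of
      \<open>x \<bullet> b\<close>\<close>
    define p where "p b x = - 1 / (\<epsilon> * real (2 * d + 2)) * f' b x" for b x
    have "p b \<in> polynomials (2 * d)" if "b \<in> E" for b
      unfolding p_def using f'(1)[OF that] polynomials_mono[of d "2 * d"]
      by (intro polynomials_scale) auto
    moreover have "(x \<bullet> b) ^ Suc (2 * d) = p b x" if x: "x \<in> m ` \<X>" and b: "b \<in> E" for x b
    proof -
      obtain X where X: "X \<in> \<X>" "x = m X"
        using x by blast
      let ?g = "\<lambda>t. f (x + t *\<^sub>R b) + \<epsilon> * h (x + t *\<^sub>R b)"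
      have deriv: "(?g has_real_derivative f' b x + \<epsilon> * (real (2 * d + 2) * (x \<bullet> b) ^ (2 * d + 2 - 1))) (at 0)"
        unfolding h_def by (intro DERIV_add DERIV_cmult DERIV_power_sum f'(2) b)
      have "norm b = 1"
        using orthonormal[OF b b] by (simp add: norm_eq_sqrt_inner)
      then have min: "?g 0 \<le> ?g t" if "\<bar>0 - t\<bar> < r - infdist x X" for t
        using that m(2)[OF X(1), of "x + t *\<^sub>R b"] infdist_triangle[of "x + t *\<^sub>R b" X x] X(2)
        by (simp add: dist_norm)
      have "r - infdist x X > 0"
        using m(1) X by simp
      then have "f' b x + \<epsilon> * (real (2 * d + 2) * (x \<bullet> b) ^ (2 * d + 2 - 1)) = 0"
        using min by (intro DERIV_local_min[OF deriv, of "r - infdist x X"]) simp_all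
      moreover have "real (2 * d + 2) \<noteq> 0"
        by linarith
      ultimately show ?thesis
        using \<open>\<epsilon> > 0\<close> unfolding p_def by (simp add: field_simps del: of_nat_add of_nat_mult of_nat_Suc)
    qed
    ultimately show ?thesis
      using \<X>(1) by (intro card_diagonal_system_le[of _ p]) auto
  qed
  finally show ?thesis
    by simp
qed

end

section \<open>Orthonormal coordinates on a Hermitian space\<close>

lemma orthonormal_coordinates_exist:
  fixes B :: "'v::real_inner set"
  assumes "finite B" "span B = UNIV"
  shows "\<exists>E :: 'v set. orthonormal_coordinates E"
proof -
  obtain C :: "'v set" where C: "finite C" "span C = UNIV" "pairwise orthogonal C"
    using basis_orthogonal[OF assms(1)] assms(2) by auto
  define E where "E = (\<lambda>x. (1 / norm x) *\<^sub>R x) ` (C - {0})"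
  have "span E = UNIV"
  proof -
    have "x \<in> span E" if "x \<in> C" for x
    proof (cases "x = 0")
      case False
      then have "norm x *\<^sub>R ((1 / norm x) *\<^sub>R x) \<in> span E"
        using that by (intro span_scale span_base) (auto simp: E_def)
      then show ?thesis
        using False by simp
    qed (simp add: span_zero)
    then show ?thesis
      using C(2) by (metis span_minimal subspace_span subsetI top.extremum_uniqueI)
  qed
  moreover have "e \<bullet> e' = (if e = e' then 1 else 0)" if e: "e \<in> E" and e': "e' \<in> E" for e e'
  proof -
    obtain x y where xy: "x \<in> C" "x \<noteq> 0" "e = (1 / norm x) *\<^sub>R x" "y \<in> C" "y \<noteq> 0" "e' = (1 / norm y) *\<^sub>R y"
      using e e' by (auto simp: E_def)
    show ?thesis
    proof (cases "x = y")
      case True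
      have "x \<bullet> x = norm x * norm x"
        by (simp add: dot_square_norm power2_eq_square)
      then show ?thesis
        using xy True by simp
    next
      case False
      then have "x \<bullet> y = 0"
        using C(3) xy by (auto simp: pairwise_def orthogonal_def)
      then have "e \<bullet> e' = 0" "e \<bullet> e \<noteq> 0"
        using xy by simp_all
      then show ?thesis
        by auto
    qed
  qed
  ultimately have "orthonormal_coordinates E"
    using C(1) by unfold_locales (auto simp: E_def)
  then show ?thesis ..
qed

context hermitian_space
begin

lemma scaleC_vector_space: "vector_space scaleC"
  using finite_dim finite_dimensional_vector_space.axioms(1) by blast

text \<open>
  A complex spanning set \<open>B\<close> yields the real spanning set \<open>B \<union> \<i> B\<close>.
\<close>

lemma orthonormal_coordinates: "\<exists>E :: 'v set. orthonormal_coordinates E"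
proof -
  interpret vector_space scaleC
    by (rule scaleC_vector_space)
  obtain B where B: "finite B" "module.span scaleC B = (UNIV :: 'v set)"
    using finite_dim by (auto simp: finite_dimensional_vector_space_def
        finite_dimensional_vector_space_axioms_def)
  let ?R = "B \<union> scaleC \<i> ` B"
  have "x \<in> Real_Vector_Spaces.span ?R" for x
  proof -
    have "x \<in> module.span scaleC B"
      using B by simp
    then show ?thesis
    proof (induction rule: span_induct_alt)
      case base
      show ?case
        by (rule Real_Vector_Spaces.span_zero)
    next
      case (step a b y)
      have "scaleC a b = Re a *\<^sub>R b + Im a *\<^sub>R scaleC \<i> b"
      proof -
        have "scaleC a b = scaleC (complex_of_real (Re a) + complex_of_real (Im a) * \<i>) b"
          by (simp add: complex_eq mult.commute)
        also have "\<dots> = Re a *\<^sub>R b + Im a *\<^sub>R scaleC \<i> b"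
          by (simp only: scale_left_distrib scaleC_of_real flip: scale_scale)
        finally show ?thesis .
      qed
      moreover have "b \<in> ?R" "scaleC \<i> b \<in> ?R"
        using step(1) by auto
      ultimately show ?case
        using step(2) by (simp only: Real_Vector_Spaces.span_add Real_Vector_Spaces.span_scale
            Real_Vector_Spaces.span_base)
    qed
  qed
  then show ?thesis
    using B(1) by (intro orthonormal_coordinates_exist[of ?R]) auto
qed

lemma Im_herm: "Im (herm x y) = - (scaleC \<i> x \<bullet> y)"
  using Re_herm[of "scaleC \<i> x" y] by (simp add: herm_scaleC_left)

lemma linear_scaleC: "linear (scaleC a)"
proof -
  interpret vector_space scaleC
    by (rule scaleC_vector_space)
  show ?thesis
  proof (rule Real_Vector_Spaces.linearI)
    show "scaleC a (x + y) = scaleC a x + scaleC a y" for x y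
      by (rule scale_right_distrib)
    show "scaleC a (r *\<^sub>R x) = r *\<^sub>R scaleC a x" for r x
      by (simp only: scaleC_of_real[symmetric] scale_scale mult.commute)
  qed
qed

end

section \<open>Derivatives in charts\<close>

lemma smooth_map_differentiable:
  assumes "smooth_map T \<A> T' \<A>' f" "(U, \<phi>) \<in> \<A>" "(W, \<psi>) \<in> \<A>'" "x \<in> U" "f x \<in> W"
  shows "(\<psi> \<circ> f \<circ> inv_into U \<phi>) differentiable (at (\<phi> x))"
proof -
  have "Ck_on (Suc 0) (\<phi> ` (U \<inter> f -` W)) (\<psi> \<circ> f \<circ> inv_into U \<phi>)"
    using assms unfolding smooth_map_def smooth_on_def by blast
  then show ?thesis
    using assms by auto
qed

lemma chart_on_inj:
  assumes "chart_on T (U, \<phi>)"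
  shows "inj_on \<phi> U"
proof -
  have "topspace (subtopology T U) = U"
    using assms openin_subset by (fastforce simp: chart_on_def topspace_subtopology)
  then show ?thesis
    using assms homeomorphic_imp_injective_map by (fastforce simp: chart_on_def)
qed

lemma chart_on_open_image:
  assumes "chart_on T (U, \<phi>)" "openin T N"
  shows "open (\<phi> ` (U \<inter> N))"
proof -
  have "openin (subtopology T U) (U \<inter> N)"
    using assms(2) by (rule openin_subtopology_Int2)
  then have "openin (top_of_set (\<phi> ` U)) (\<phi> ` (U \<inter> N))"
    using assms(1) homeomorphic_imp_open_map by (fastforce simp: chart_on_def open_map_def)
  then show ?thesis
    using assms(1) openin_open_trans by (fastforce simp: chart_on_def)
qed

text \<open>
  Outside the chart domain \<open>inv_into U \<phi>\<close> has arbitrary values. Identities between functions on a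
  manifold therefore carry over to their chart expressions only near the base point, which suffices
  for derivatives.
\<close>

lemma has_derivative_chart_cong:
  assumes "chart_on T (U, \<phi>)" "x \<in> U"
    and "((f \<circ> inv_into U \<phi>) has_derivative D) (at (\<phi> x))"
    and "openin T N" "x \<in> N" "\<And>y. y \<in> U \<Longrightarrow> y \<in> N \<Longrightarrow> f y = g y"
  shows "((g \<circ> inv_into U \<phi>) has_derivative D) (at (\<phi> x))"
proof (rule has_derivative_transform_within_open[OF assms(3) chart_on_open_image[OF assms(1,4)]])
  show "\<phi> x \<in> \<phi> ` (U \<inter> N)"
    using assms by blast
  show "(f \<circ> inv_into U \<phi>) v = (g \<circ> inv_into U \<phi>) v" if "v \<in> \<phi> ` (U \<inter> N)" for v
    using that chart_on_inj[OF assms(1)] assms(6) by auto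
qed

lemma has_derivative_chart_compose:
  assumes U: "chart_on T (U, \<phi>)" and W: "chart_on T (W, \<psi>)"
    and F: "continuous_map T T F" "x \<in> U" "F x \<in> W"
    and D: "((\<psi> \<circ> F \<circ> inv_into U \<phi>) has_derivative D) (at (\<phi> x))"
    and D': "((h \<circ> inv_into W \<psi>) has_derivative D') (at (\<psi> (F x)))"
  shows "((h \<circ> F \<circ> inv_into U \<phi>) has_derivative D' \<circ> D) (at (\<phi> x))"
proof (rule has_derivative_chart_cong[OF U F(2)])
  have "(\<psi> \<circ> F \<circ> inv_into U \<phi>) (\<phi> x) = \<psi> (F x)"
    using chart_on_inj[OF U] F(2) by simp
  then have "((h \<circ> inv_into W \<psi>) \<circ> (\<psi> \<circ> F \<circ> inv_into U \<phi>) has_derivative D' \<circ> D) (at (\<phi> x))"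
    using D D' by (intro diff_chain_at) simp_all
  then show "((h \<circ> inv_into W \<psi> \<circ> \<psi> \<circ> F) \<circ> inv_into U \<phi> has_derivative D' \<circ> D) (at (\<phi> x))"
    by (simp only: comp_assoc)
  have "openin T W" "U \<subseteq> topspace T"
    using U W openin_subset by (auto simp: chart_on_def)
  then show "openin T {y \<in> topspace T. F y \<in> W}" "x \<in> {y \<in> topspace T. F y \<in> W}"
    using F openin_continuous_map_preimage by auto
  show "(h \<circ> inv_into W \<psi> \<circ> \<psi> \<circ> F) y = (h \<circ> F) y" if "y \<in> {y \<in> topspace T. F y \<in> W}" for y
    using that chart_on_inj[OF W] by simp
qed

section \<open>The adjoint action\<close>

context lie_group
begin

lemma chart: "(U, \<phi>) \<in> \<A> \<Longrightarrow> chart_on T (U, \<phi>)"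
  using manifold unfolding smooth_manifold_def by blast

lemma chart_subset_carrier: "(U, \<phi>) \<in> \<A> \<Longrightarrow> U \<subseteq> carrier G"
  using chart openin_subset topspace by (fastforce simp: chart_on_def)

lemma chart_exists:
  assumes "k \<in> carrier G"
  obtains U \<phi> where "(U, \<phi>) \<in> \<A>" "k \<in> U"
proof -
  have "k \<in> (\<Union>(U, \<phi>)\<in>\<A>. U)"
    using assms manifold topspace unfolding smooth_manifold_def by blast
  then show ?thesis
    using that by auto
qed

text \<open>
  The inverse of a product chart is split into its factors, so that one argument can be held fixed.
\<close>

lemma mult_differentiable:
  assumes "(U, \<phi>) \<in> \<A>" "(V, \<theta>) \<in> \<A>" "(W, \<psi>) \<in> \<A>" "g \<in> U" "k \<in> V" "g \<otimes> k \<in> W"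
  shows "(\<lambda>(x, y). \<psi> (inv_into U \<phi> x \<otimes> inv_into V \<theta> y)) differentiable (at (\<phi> g, \<theta> k))"
proof -
  let ?m = "\<psi> \<circ> (\<lambda>(g, h). g \<otimes> h) \<circ> inv_into (U \<times> V) (map_prod \<phi> \<theta>)"
  have inj: "inj_on \<phi> U" "inj_on \<theta> V"
    using assms chart_on_inj chart by blast+
  have "(U \<times> V, map_prod \<phi> \<theta>) \<in> prod_atlas \<A> \<A>"
    using assms by (auto simp: prod_atlas_def)
  from smooth_map_differentiable[OF smooth_mult this assms(3), of "(g, k)"]
  have "?m differentiable (at (\<phi> g, \<theta> k))"
    using assms by simp
  then obtain D where D: "(?m has_derivative D) (at (\<phi> g, \<theta> k))"
    by (auto simp: differentiable_def)
  have "((\<lambda>(x, y). \<psi> (inv_into U \<phi> x \<otimes> inv_into V \<theta> y)) has_derivative D) (at (\<phi> g, \<theta> k))"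
  proof (rule has_derivative_transform_within_open[OF D])
    show "open (\<phi> ` U \<times> \<theta> ` V)"
      using chart[OF assms(1)] chart[OF assms(2)] by (auto simp: chart_on_def intro: open_Times)
    show "(\<phi> g, \<theta> k) \<in> \<phi> ` U \<times> \<theta> ` V"
      using assms by auto
    fix v assume "v \<in> \<phi> ` U \<times> \<theta> ` V"
    then obtain a b where ab: "a \<in> U" "b \<in> V" "v = map_prod \<phi> \<theta> (a, b)"
      by auto
    have "inj_on (map_prod \<phi> \<theta>) (U \<times> V)"
      using inj by (rule map_prod_inj_on)
    then have "inv_into (U \<times> V) (map_prod \<phi> \<theta>) v = (a, b)"
      using ab by (metis SigmaI inv_into_f_f)
    then show "?m v = (case v of (x, y) \<Rightarrow> \<psi> (inv_into U \<phi> x \<otimes> inv_into V \<theta> y))"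
      using ab inj by simp
  qed
  then show ?thesis
    by (rule differentiableI)
qed

lemma left_translation_differentiable:
  assumes "(U, \<phi>) \<in> \<A>" "(W, \<psi>) \<in> \<A>" "k \<in> carrier G" "g \<in> U" "k \<otimes> g \<in> W"
  shows "(\<psi> \<circ> (\<lambda>g. k \<otimes> g) \<circ> inv_into U \<phi>) differentiable (at (\<phi> g))"
proof -
  obtain V \<theta> where V: "(V, \<theta>) \<in> \<A>" "k \<in> V"
    using chart_exists assms(3) by blast
  have "((\<lambda>(x, y). \<psi> (inv_into V \<theta> x \<otimes> inv_into U \<phi> y)) \<circ> (\<lambda>y. (\<theta> k, y)))
      differentiable (at (\<phi> g))"
    using mult_differentiable[OF V(1) assms(1,2) V(2) assms(4,5)]
    by (intro differentiable_chain_at) (auto intro!: derivative_intros simp: differentiable_Pair)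
  moreover have "inv_into V \<theta> (\<theta> k) = k"
    using V chart chart_on_inj by (metis inv_into_f_f)
  ultimately show ?thesis
    by (simp add: comp_def)
qed

lemma right_translation_differentiable:
  assumes "(U, \<phi>) \<in> \<A>" "(W, \<psi>) \<in> \<A>" "k \<in> carrier G" "g \<in> U" "g \<otimes> k \<in> W"
  shows "(\<psi> \<circ> (\<lambda>g. g \<otimes> k) \<circ> inv_into U \<phi>) differentiable (at (\<phi> g))"
proof -
  obtain V \<theta> where V: "(V, \<theta>) \<in> \<A>" "k \<in> V"
    using chart_exists assms(3) by blast
  have "((\<lambda>(x, y). \<psi> (inv_into U \<phi> x \<otimes> inv_into V \<theta> y)) \<circ> (\<lambda>x. (x, \<theta> k)))
      differentiable (at (\<phi> g))"
    using mult_differentiable[OF assms(1) V(1) assms(2,4) V(2) assms(5)]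
    by (intro differentiable_chain_at) (auto intro!: derivative_intros simp: differentiable_Pair)
  moreover have "inv_into V \<theta> (\<theta> k) = k"
    using V chart chart_on_inj by (metis inv_into_f_f)
  ultimately show ?thesis
    by (simp add: comp_def)
qed

lemma continuous_mult: "continuous_map (prod_topology T T) T (\<lambda>(g, h). g \<otimes> h)"
  using smooth_mult by (simp add: smooth_map_def)

lemma continuous_left_translation:
  assumes "k \<in> carrier G"
  shows "continuous_map T T (\<lambda>g. k \<otimes> g)"
proof -
  have "continuous_map T (prod_topology T T) (\<lambda>g. (k, g))"
    using assms by (simp add: continuous_map_paired topspace)
  from continuous_map_compose[OF this continuous_mult] show ?thesis
    by (simp add: comp_def)
qed

lemma continuous_right_translation:
  assumes "k \<in> carrier G"
  shows "continuous_map T T (\<lambda>g. g \<otimes> k)"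
proof -
  have "continuous_map T (prod_topology T T) (\<lambda>g. (g, k))"
    using assms by (simp add: continuous_map_paired topspace)
  from continuous_map_compose[OF this continuous_mult] show ?thesis
    by (simp add: comp_def)
qed

abbreviation conjugation :: "'k \<Rightarrow> 'k \<Rightarrow> 'k" where
  "conjugation k g \<equiv> k \<otimes> g \<otimes> inv k"

lemma continuous_conjugation:
  assumes "k \<in> carrier G"
  shows "continuous_map T T (conjugation k)"
proof -
  have "continuous_map T T ((\<lambda>g. g \<otimes> inv k) \<circ> (\<lambda>g. k \<otimes> g))"
    using continuous_left_translation[OF assms] continuous_right_translation[OF inv_closed[OF assms]]
    by (rule continuous_map_compose)
  then show ?thesis
    by (simp add: comp_def)
qed

text \<open>
  Left translation by \<open>k\<close> leaves the domain of the chart at the identity, so conjugation is factored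
  through a chart around \<open>k\<close>.
\<close>

lemma Ad_has_derivative:
  assumes c: "(U, \<phi>) \<in> \<A>" "\<one> \<in> U" and k: "k \<in> carrier G"
  shows "((\<phi> \<circ> conjugation k \<circ> inv_into U \<phi>) has_derivative Ad G (U, \<phi>) k) (at (\<phi> \<one>))"
proof -
  obtain W \<psi> where W: "(W, \<psi>) \<in> \<A>" "k \<in> W"
    using chart_exists k by blast
  have "(\<psi> \<circ> (\<lambda>g. k \<otimes> g) \<circ> inv_into U \<phi>) differentiable (at (\<phi> \<one>))"
    using c W k by (intro left_translation_differentiable) auto
  then obtain D where D: "((\<psi> \<circ> (\<lambda>g. k \<otimes> g) \<circ> inv_into U \<phi>) has_derivative D) (at (\<phi> \<one>))"
    by (auto simp: differentiable_def)
  have "(\<phi> \<circ> (\<lambda>g. g \<otimes> inv k) \<circ> inv_into W \<psi>) differentiable (at (\<psi> k))"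
    using c W k by (intro right_translation_differentiable) auto
  then obtain D' where
    "(((\<phi> \<circ> (\<lambda>g. g \<otimes> inv k)) \<circ> inv_into W \<psi>) has_derivative D') (at (\<psi> k))"
    by (auto simp: differentiable_def)
  then have "((\<phi> \<circ> (\<lambda>g. g \<otimes> inv k) \<circ> (\<lambda>g. k \<otimes> g) \<circ> inv_into U \<phi>) has_derivative D' \<circ> D) (at (\<phi> \<one>))"
    using c W k D by (intro has_derivative_chart_compose[OF chart[OF c(1)] chart[OF W(1)]]
        continuous_left_translation) auto
  then have "(\<phi> \<circ> conjugation k \<circ> inv_into U \<phi>) differentiable (at (\<phi> \<one>))"
    by (auto simp: comp_def differentiable_def)
  then show ?thesis
    by (simp add: Ad_def differential_at_identity_def frechet_derivative_works comp_def)
qed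

lemma has_derivative_conjugation_compose:
  assumes c: "(U, \<phi>) \<in> \<A>" "\<one> \<in> U" and k: "k \<in> carrier G"
    and h: "((h \<circ> inv_into U \<phi>) has_derivative D) (at (\<phi> \<one>))"
  shows "((h \<circ> conjugation k \<circ> inv_into U \<phi>) has_derivative D \<circ> Ad G (U, \<phi>) k) (at (\<phi> \<one>))"
  using c k h
  by (intro has_derivative_chart_compose[OF chart[OF c(1)] chart[OF c(1)]]
      continuous_conjugation Ad_has_derivative) auto

lemma has_derivative_chart_id:
  assumes c: "(U, \<phi>) \<in> \<A>" "\<one> \<in> U" and "\<And>g. g \<in> U \<Longrightarrow> f g = \<phi> g"
  shows "((f \<circ> inv_into U \<phi>) has_derivative (\<lambda>A. A)) (at (\<phi> \<one>))"
proof (rule has_derivative_transform_within_open[OF has_derivative_ident])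
  show "open (\<phi> ` U)"
    using chart[OF c(1)] by (simp add: chart_on_def)
  show "\<phi> \<one> \<in> \<phi> ` U"
    using c by simp
  show "v = (f \<circ> inv_into U \<phi>) v" if "v \<in> \<phi> ` U" for v
    using that assms(3) by (auto simp: inv_into_into f_inv_into_f)
qed

text \<open>
  Conjugation by \<open>k\<close> followed by conjugation by its inverse is the identity; this is the chain rule
  at the fixed point \<open>\<one>\<close> of both maps.
\<close>

lemma Ad_inv_Ad:
  assumes c: "(U, \<phi>) \<in> \<A>" "\<one> \<in> U" and k: "k \<in> carrier G"
  shows "Ad G (U, \<phi>) (inv k) (Ad G (U, \<phi>) k A) = A"
proof -
  have "((\<phi> \<circ> conjugation (inv k) \<circ> conjugation k \<circ> inv_into U \<phi>) has_derivative
      Ad G (U, \<phi>) (inv k) \<circ> Ad G (U, \<phi>) k) (at (\<phi> \<one>))"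
    using c k by (intro has_derivative_conjugation_compose Ad_has_derivative) auto
  moreover have "((\<phi> \<circ> conjugation (inv k) \<circ> conjugation k \<circ> inv_into U \<phi>) has_derivative (\<lambda>A. A))
      (at (\<phi> \<one>))"
  proof (rule has_derivative_chart_id[OF c])
    fix g assume "g \<in> U"
    then have "g \<in> carrier G"
      using chart_subset_carrier[OF c(1)] by blast
    then have "conjugation (inv k) (conjugation k g) = g"
      using k by (simp add: m_assoc inv_solve_left')
    then show "(\<phi> \<circ> conjugation (inv k) \<circ> conjugation k) g = \<phi> g"
      by simp
  qed
  ultimately have "Ad G (U, \<phi>) (inv k) \<circ> Ad G (U, \<phi>) k = (\<lambda>A. A)"
    by (rule has_derivative_unique)
  then show ?thesis
    by (metis comp_apply)
qed

lemma Ad_one: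
  assumes c: "(U, \<phi>) \<in> \<A>" "\<one> \<in> U"
  shows "Ad G (U, \<phi>) \<one> A = A"
proof -
  have "((\<phi> \<circ> conjugation \<one> \<circ> inv_into U \<phi>) has_derivative (\<lambda>A. A)) (at (\<phi> \<one>))"
    using chart_subset_carrier[OF c(1)] by (intro has_derivative_chart_id[OF c]) auto
  with Ad_has_derivative[OF c one_closed] have "Ad G (U, \<phi>) \<one> = (\<lambda>A. A)"
    by (rule has_derivative_unique)
  then show ?thesis
    by simp
qed

end

section \<open>The moment map\<close>

context unitary_lie_group_rep
begin

lemma linear_rep: "k \<in> carrier G \<Longrightarrow> linear (\<rho> k)"
proof -
  assume k: "k \<in> carrier G"
  interpret r: Vector_Spaces.linear scaleC scaleC "\<rho> k"
    using rep_linear[OF k] .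
  show ?thesis
  proof (rule Real_Vector_Spaces.linearI)
    show "\<rho> k (a *\<^sub>R x) = a *\<^sub>R \<rho> k x" for a x
      by (simp only: scaleC_of_real[symmetric] r.scale)
  qed (rule r.add)
qed

lemma bounded_linear_rep:
  assumes "k \<in> carrier G"
  shows "bounded_linear (\<rho> k)"
proof -
  have "\<rho> k x \<bullet> \<rho> k x = x \<bullet> x" for x
    using rep_unitary[OF assms, of x x] by (simp flip: Re_herm)
  then have "norm (\<rho> k x) \<le> norm x * 1" for x
    by (simp add: norm_eq_sqrt_inner)
  then show ?thesis
    using linear_rep[OF assms]
    by (intro bounded_linear_intro[where K = 1]) (auto simp: linear_add linear_scale)
qed

lemma rep_mult: "k \<in> carrier G \<Longrightarrow> l \<in> carrier G \<Longrightarrow> \<rho> (k \<otimes> l) z = \<rho> k (\<rho> l z)"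
  by (rule composition_rule) auto

lemma rep_rep_inv: "k \<in> carrier G \<Longrightarrow> \<rho> k (\<rho> (inv k) z) = z"
  using orbit_sym_aux[of "inv k" z] by simp

lemma continuous_rep: "continuous_map T euclidean (\<lambda>k. \<rho> k z)"
  using rep_smooth by (simp add: smooth_map_def)

lemma compact_orbit:
  assumes "compact_space T" "X \<in> orbits G UNIV \<rho>"
  shows "compact X"
proof -
  obtain z where "X = (\<lambda>k. \<rho> k z) ` carrier G"
    using assms(2) by (auto simp: orbits_def orbit_def)
  moreover have "compactin euclidean ((\<lambda>k. \<rho> k z) ` topspace T)"
    using assms(1) continuous_rep unfolding compact_space_def by (rule image_compactin)
  ultimately show ?thesis
    using topspace by simp
qed

context
  fixes U :: "'k set" and \<phi> :: "'k \<Rightarrow> 'e"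
  assumes U: "(U, \<phi>) \<in> \<A>" and one: "\<one> \<in> U"
begin

abbreviation dact where "dact \<equiv> derived_action G (U, \<phi>) \<rho>"
abbreviation \<tau> where "\<tau> \<equiv> moment_map G (U, \<phi>) herm \<rho>"

lemma derived_action_has_derivative:
  "(((\<lambda>k. \<rho> k z) \<circ> inv_into U \<phi>) has_derivative (\<lambda>A. dact A z)) (at (\<phi> \<one>))"
proof -
  have "(UNIV, id) \<in> (vector_space_atlas :: ('v, 'v) chart set)"
    by (simp add: vector_space_atlas_def)
  from smooth_map_differentiable[OF rep_smooth U this one]
  have "((\<lambda>k. \<rho> k z) \<circ> inv_into U \<phi>) differentiable (at (\<phi> \<one>))"
    by simp
  then show ?thesis
    by (simp add: derived_action_def differential_at_identity_def frechet_derivative_works)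
qed

lemma derived_action_unique:
  assumes "((f \<circ> inv_into U \<phi>) has_derivative D) (at (\<phi> \<one>))" "\<And>k. k \<in> U \<Longrightarrow> f k = \<rho> k z"
  shows "dact A z = D A"
proof -
  have "openin T U"
    using chart[OF U] by (simp add: chart_on_def)
  then have "(((\<lambda>k. \<rho> k z) \<circ> inv_into U \<phi>) has_derivative D) (at (\<phi> \<one>))"
    by (intro has_derivative_chart_cong[OF chart[OF U] one assms(1), where N = U] one assms(2))
  from has_derivative_unique[OF derived_action_has_derivative this] show ?thesis
    by (rule fun_cong)
qed

lemma linear_derived_action: "linear (dact A)"
proof (rule Real_Vector_Spaces.linearI)
  have lin: "linear (\<rho> k)" if "k \<in> U" for k
    using that chart_subset_carrier[OF U] linear_rep by blast
  show "dact A (x + y) = dact A x + dact A y" for x y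
  proof (rule derived_action_unique)
    show "((\<lambda>k. \<rho> k x + \<rho> k y) \<circ> inv_into U \<phi> has_derivative (\<lambda>A. dact A x + dact A y)) (at (\<phi> \<one>))"
      using has_derivative_add[OF derived_action_has_derivative derived_action_has_derivative]
      by (simp add: comp_def)
  qed (simp add: lin linear_add)
  show "dact A (r *\<^sub>R x) = r *\<^sub>R dact A x" for r x
  proof (rule derived_action_unique)
    show "((\<lambda>k. r *\<^sub>R \<rho> k x) \<circ> inv_into U \<phi> has_derivative (\<lambda>A. r *\<^sub>R dact A x)) (at (\<phi> \<one>))"
      using has_derivative_scaleR_right[OF derived_action_has_derivative]
      by (simp add: comp_def)
  qed (simp add: lin linear_scale)
qed

text \<open>
  Differentiate \<open>\<rho> k\<inverse> (\<rho> (k g k\<inverse>) z) = \<rho> g (\<rho> k\<inverse> z)\<close> with respect to \<open>g\<close> at the identity.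
\<close>

lemma derived_action_Ad:
  assumes k: "k \<in> carrier G"
  shows "dact (Ad G (U, \<phi>) k A) z = \<rho> k (dact A (\<rho> (inv k) z))"
proof -
  have "(((\<lambda>g. \<rho> g z) \<circ> conjugation k \<circ> inv_into U \<phi>) has_derivative (\<lambda>A. dact A z) \<circ> Ad G (U, \<phi>) k)
      (at (\<phi> \<one>))"
    by (rule has_derivative_conjugation_compose[OF U one k derived_action_has_derivative])
  then have D: "(((\<lambda>g. \<rho> (conjugation k g) z) \<circ> inv_into U \<phi>) has_derivative
      (\<lambda>A. dact (Ad G (U, \<phi>) k A) z)) (at (\<phi> \<one>))"
    by (simp add: comp_def)
  have "((\<lambda>g. \<rho> (inv k) (\<rho> (conjugation k g) z)) \<circ> inv_into U \<phi> has_derivative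
      (\<lambda>A. \<rho> (inv k) (dact (Ad G (U, \<phi>) k A) z))) (at (\<phi> \<one>))"
    using bounded_linear.has_derivative[OF bounded_linear_rep[OF inv_closed[OF k]] D]
    by (simp add: comp_def)
  moreover have "\<rho> (inv k) (\<rho> (conjugation k g) z) = \<rho> g (\<rho> (inv k) z)" if "g \<in> U" for g
  proof -
    have g: "g \<in> carrier G"
      using that chart_subset_carrier[OF U] by blast
    then have "inv k \<otimes> conjugation k g = g \<otimes> inv k"
      using k by (simp add: m_assoc inv_solve_left')
    then show ?thesis
      using g k by (metis rep_mult inv_closed m_closed)
  qed
  ultimately have "dact A (\<rho> (inv k) z) = \<rho> (inv k) (dact (Ad G (U, \<phi>) k A) z)"
    by (rule derived_action_unique)
  then show ?thesis
    using rep_rep_inv[OF k] by simp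
qed

text \<open>
  Equivariance of the moment map: \<open>\<rho> k\<close> can be applied to both arguments of the invariant Hermitian
  form.
\<close>

lemma moment_map_rep_inv:
  assumes "k \<in> carrier G"
  shows "\<tau> (\<rho> (inv k) z) A = \<tau> z (Ad G (U, \<phi>) k A)"
proof -
  have "herm (\<rho> (inv k) z) (dact A (\<rho> (inv k) z)) =
      herm (\<rho> k (\<rho> (inv k) z)) (\<rho> k (dact A (\<rho> (inv k) z)))"
    using rep_unitary[OF assms] by simp
  then show ?thesis
    using assms by (simp add: moment_map_def rep_rep_inv derived_action_Ad)
qed

text \<open>
  As multiplication by \<open>\<i>\<close> and the derived action are linear, this exhibits the moment map as a real
  quadratic form.
\<close>

lemma moment_map_eq: "\<tau> z A = - (scaleC \<i> z \<bullet> dact A z)"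
  by (simp add: moment_map_def Im_herm)

lemma linear_moment_map: "linear (\<tau> z)"
proof -
  have "linear (\<lambda>A. dact A z)"
    using derived_action_has_derivative by (rule has_derivative_linear)
  from linear_add[OF this] linear_scale[OF this] show ?thesis
    by (intro Real_Vector_Spaces.linearI) (simp_all add: moment_map_eq inner_add_right)
qed

lemma moment_preimage_if_eq:
  assumes "\<tau> z = \<alpha>"
  shows "z \<in> moment_preimage G (U, \<phi>) herm \<rho> \<alpha>"
proof -
  have "coAd G (U, \<phi>) \<one> \<alpha> = \<alpha>"
    using Ad_one[OF U one] by (simp add: coAd_def comp_def)
  then have "\<alpha> \<in> orbit G (coAd G (U, \<phi>)) \<alpha>"
    unfolding orbit_def by (metis (mono_tags, lifting) mem_Collect_eq one_closed)
  then show ?thesis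
    using assms by (simp add: moment_preimage_def)
qed

lemma moment_preimage_meets_fibre:
  assumes "z \<in> moment_preimage G (U, \<phi>) herm \<rho> \<alpha>"
  obtains k where "k \<in> carrier G" "\<tau> (\<rho> k z) = \<alpha>"
proof -
  obtain l where l: "l \<in> carrier G" "\<tau> z = coAd G (U, \<phi>) l \<alpha>"
    using assms by (auto simp: moment_preimage_def orbit_def)
  have "\<tau> (\<rho> (inv l) z) A = \<alpha> A" for A
    using l Ad_inv_Ad[OF U one l(1)] by (simp add: moment_map_rep_inv coAd_def)
  then show ?thesis
    using l by (intro that[of "inv l"]) auto
qed

lemma moment_map_polynomial:
  fixes E :: "'v set"
  assumes "orthonormal_coordinates E"
  shows "(\<lambda>z. \<tau> z A) \<in> orthonormal_coordinates.polynomials E 2"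
proof -
  interpret orthonormal_coordinates E
    by (rule assms)
  have J: "linear (\<lambda>z. scaleC \<i> z \<bullet> e)" and D: "linear (\<lambda>z. dact A z \<bullet> e)" for e
    using linear_scaleC[of \<i>] linear_derived_action[of A]
    by (auto intro!: Real_Vector_Spaces.linearI simp: linear_add linear_scale inner_add_left)
  have inner: "x \<bullet> y = (\<Sum>e\<in>E. (x \<bullet> e) * (y \<bullet> e))" for x y
    using linear_expansion[OF bounded_linear.linear[OF bounded_linear_inner_right[of x]], of y]
    by (simp add: mult.commute)
  have "\<tau> z A = - 1 * (\<Sum>e\<in>E. (scaleC \<i> z \<bullet> e) * (dact A z \<bullet> e))" for z
    using inner[of "scaleC \<i> z" "dact A z"] by (simp only: moment_map_eq mult_minus1)
  moreover have "(\<lambda>z. - 1 * (\<Sum>e\<in>E. (scaleC \<i> z \<bullet> e) * (dact A z \<bullet> e))) \<in> polynomials (1 + 1)"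
    by (intro polynomials_scale polynomials_sum polynomials_mult polynomials_linear J D finite_E)
  ultimately show ?thesis
    by (simp only: one_add_one)
qed

text \<open>
  An orbit inside the preimage shares a point with some member of \<open>F\<close> and hence is that member; so it
  is \<open>F\<close> whose size has to be bounded. Its members are the compact pieces, and the zeros of \<open>f\<close> are
  the points of the fibre over \<open>\<alpha>\<close>.
\<close>

theorem card_orbits_in_moment_preimage_le:
  fixes E :: "'v set"
  assumes E: "orthonormal_coordinates E" and "compact_space T" and \<alpha>: "linear \<alpha>"
    and F: "finite F" "F \<subseteq> orbits G UNIV \<rho>" "moment_preimage G (U, \<phi>) herm \<rho> \<alpha> = \<Union>F"
  shows "{X \<in> orbits G UNIV \<rho>. X \<subseteq> moment_preimage G (U, \<phi>) herm \<rho> \<alpha>} = F"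
    and "card F \<le> 9 ^ card E"
proof -
  interpret orthonormal_coordinates E
    by (rule E)
  have nonempty: "X \<noteq> {}" if "X \<in> orbits G UNIV \<rho>" for X
    using that orbit_refl by (auto simp: orbits_def)
  show "{X \<in> orbits G UNIV \<rho>. X \<subseteq> moment_preimage G (U, \<phi>) herm \<rho> \<alpha>} = F"
  proof (intro equalityI subsetI)
    fix X assume X: "X \<in> {X \<in> orbits G UNIV \<rho>. X \<subseteq> moment_preimage G (U, \<phi>) herm \<rho> \<alpha>}"
    then obtain z Y where "z \<in> X" "z \<in> Y" "Y \<in> F"
      using nonempty F(3) by blast
    then show "X \<in> F"
      using disjoint_union[of X Y] X F(2) by blast
  qed (use F in auto)
  obtain B :: "'e set" where B: "finite B" "span B = UNIV"
    using manifold by (auto simp: smooth_manifold_def finite_dimensional_vector_space_def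
        finite_dimensional_vector_space_axioms_def span_raw_def)
  define f where "f z = (\<Sum>A\<in>B. (\<tau> z A + - \<alpha> A)\<^sup>2)" for z
  have f_zero: "f z = 0 \<longleftrightarrow> \<tau> z = \<alpha>" for z
  proof
    assume "f z = 0"
    then have "\<tau> z A = \<alpha> A" if "A \<in> B" for A
      using that B(1) by (simp add: f_def sum_nonneg_eq_0_iff)
    then show "\<tau> z = \<alpha>"
      using linear_eq_on_span[OF linear_moment_map \<alpha>, of B] B(2) by (intro ext) auto
  qed (simp add: f_def)
  have "card F \<le> (2 * (2 * 2) + 1) ^ card E"
  proof (rule card_zero_set_pieces_le)
    show "f \<in> polynomials (2 * 2)"
      unfolding f_def using B(1)
      by (intro polynomials_sum polynomials_square polynomials_add polynomials_const
          moment_map_polynomial E)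
    show "f z \<ge> 0" for z
      by (simp add: f_def sum_nonneg)
    show "disjoint F"
      using F(2) disjoint_union by (auto simp: disjoint_def)
    show "compact X" if "X \<in> F" for X
      using that F(2) compact_orbit[OF \<open>compact_space T\<close>] by blast
    show "z \<in> \<Union>F" if "f z = 0" for z
      using that f_zero moment_preimage_if_eq F(3) by blast
    show "\<exists>z\<in>X. f z = 0" if X: "X \<in> F" for X
    proof -
      obtain x where x: "X = orbit G \<rho> x"
        using X F(2) by (auto simp: orbits_def)
      then have "x \<in> moment_preimage G (U, \<phi>) herm \<rho> \<alpha>"
        using X F(3) orbit_refl[of x] by blast
      then obtain k where "k \<in> carrier G" "\<tau> (\<rho> k x) = \<alpha>"
        by (rule moment_preimage_meets_fibre)
      then show ?thesis
        using x f_zero by (auto simp: orbit_def)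
    qed
  qed (rule F(1))
  then show "card F \<le> 9 ^ card E"
    by simp
qed

end

end

theorem mainTheorem4:
  fixes G :: "('k, 'r) monoid_scheme"
    and T :: "'k topology"
    and \<A> :: "('k, 'e::real_normed_vector) chart set"
    and c :: "('k, 'e) chart"
    and scaleC :: "complex \<Rightarrow> 'v::real_inner \<Rightarrow> 'v"
    and herm :: "'v \<Rightarrow> 'v \<Rightarrow> complex"
    and \<rho> :: "'k \<Rightarrow> 'v \<Rightarrow> 'v"
  assumes "unitary_lie_group_rep G T \<A> scaleC herm \<rho>"
    and "compact_space T"
    and "connected_space T"
    and "identity_chart G \<A> c"
    and "finite_to_one_on_orbits G c herm \<rho>"
  shows "uniformly_finite_to_one_on_orbits G c herm \<rho>"
proof -
  interpret unitary_lie_group_rep G T \<A> scaleC herm \<rho>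
    by (rule assms(1))
  obtain U \<phi> where c: "c = (U, \<phi>)" "(U, \<phi>) \<in> \<A>" "\<one>\<^bsub>G\<^esub> \<in> U"
    using assms(4) by (cases c) (auto simp: identity_chart_def)
  obtain E :: "'v set" where E: "orthonormal_coordinates E"
    using orthonormal_coordinates by blast
  show ?thesis
    unfolding uniformly_finite_to_one_on_orbits_def
  proof (intro exI[of _ "9 ^ card E"] ballI)
    fix \<alpha> :: "'e \<Rightarrow> real" assume \<alpha>: "\<alpha> \<in> lie_algebra_dual"
    from bspec[OF assms(5)[unfolded finite_to_one_on_orbits_def] \<alpha>] obtain F where F:
      "finite F" "F \<subseteq> orbits G UNIV \<rho>" "moment_preimage G c herm \<rho> \<alpha> = \<Union>F"
      by (elim exE conjE)
    have "linear \<alpha>"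
      using \<alpha> by (simp add: lie_algebra_dual_def)
    note le = card_orbits_in_moment_preimage_le[OF c(2,3) E assms(2) this F(1,2) F(3)[unfolded c(1)]]
    show "finite {X \<in> orbits G UNIV \<rho>. X \<subseteq> moment_preimage G c herm \<rho> \<alpha>} \<and>
        card {X \<in> orbits G UNIV \<rho>. X \<subseteq> moment_preimage G c herm \<rho> \<alpha>} \<le> 9 ^ card E"
      using F(1) le(2) unfolding c(1) le(1) by (rule conjI)
  qed
qed

end
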